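(* For integers $0\leq k\leq n$, \[ (1-q)^{n-k} S_1[n,k] = \sum_{j=0}^{n-k} \sum_{i=j}^{n-k} (-1)^j\, B^{n,k}_{i,j}\, q^{\binom{j+1}2} \begin{bmatrix} i\\ j\end{bmatrix}_q . \]
   Context: $q$-binomial coefficients: $[i]_q=1+q+\dots+q^{i-1}$, $[n]_q!=[1]_q\cdots[n]_q$, $\begin{bmatrix} n\\ k\end{bmatrix}_q=\frac{[n]_q!}{[k]_q![n-k]_q!}$ for $0\leq k\leq n$, and $0$ if $k<0$ or $k>n$. For integers $0\leq j\leq i\leq n-k$, \[ B^{n,k}_{i,j}=\binom{n+j-1}{k-1}\binom{n-i-1}{k-1}-\binom{n+j}{k-1}\binom{n-i-2}{k-1}, \] which also equals $\frac{i+j+1}{n+j}\binom{n+j}{k-1}\binom{n-i-2}{k-2}$; here the conventions $\binom{-2}{-2}=\binom{-1}{-1}=1$ and $\binom{u}{v}=0$ if $v<0$ and $u>v$ are used. For $n\geq 0$ let $\mathfrak{S}_n$ be the set of permutations of $\{1,\dots,n\}$. For $\sigma\in\mathfrak{S}_n$, a right-to-left maximum is an index $i$ such that $\sigma(i)>\sigma(j)$ for all $j$ with $i<j\leq n$; let $\mathrm{rlm}(\sigma)$ be their number. An inversion of $\sigma$ is a pair $(i,j)$ with $i<j$ and $\sigma(i)>\sigma(j)$; it is special if there exists $k'$ with $j<k'\leq n$ and $\sigma(i)<\sigma(k')$. Let $\mathrm{inv}'(\sigma)$ be the number of special inversions. Define $S_1[n,k]=\sum_{\sigma} q^{\mathrm{inv}'(\sigma)}$,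 summed over $\sigma\in\mathfrak{S}_n$ with $\mathrm{rlm}(\sigma)=k$. *)

theory Defs
  imports "HOL-Computational_Algebra.Polynomial" "HOL-Combinatorics.Permutations"
begin

text \<open>The indeterminate $q$; the identity is one between polynomials in $q$ with integer
  coefficients.\<close>

abbreviation qvar :: "int poly" where
  "qvar \<equiv> [:0, 1:]"

definition qnum :: "nat \<Rightarrow> int poly" where
  "qnum i = (\<Sum>a<i. qvar ^ a)"

definition qfact :: "nat \<Rightarrow> int poly" where
  "qfact n = (\<Prod>i=1..n. qnum i)"

text \<open>The division is exact, see the lemma \<open>qbinom_mult\<close> below.\<close>

definition qbinom :: "nat \<Rightarrow> nat \<Rightarrow> int poly" where
  "qbinom n k = (if k \<le> n then qfact n div (qfact k * qfact (n - k)) else 0)"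

lemma qnum_split: "k \<le> n \<Longrightarrow> qnum n = qnum k + qvar ^ k * qnum (n - k)"
proof (induction n)
  case (Suc n)
  show ?case
  proof (cases "k = Suc n")
    case False
    then have "k \<le> n" using Suc.prems by simp
    with Suc.IH have "qnum n = qnum k + qvar ^ k * qnum (n - k)" by blast
    moreover have "qnum (Suc n) = qnum n + qvar ^ n"
      unfolding qnum_def by simp
    moreover have "qnum (Suc n - k) = qnum (n - k) + qvar ^ (n - k)"
      unfolding qnum_def using \<open>k \<le> n\<close> by (simp add: Suc_diff_le)
    moreover have "qvar ^ n = qvar ^ k * qvar ^ (n - k)"
      using \<open>k \<le> n\<close> by (metis le_add_diff_inverse power_add)
    ultimately show ?thesis by (simp only: distrib_left add.assoc)
  qed (simp add: qnum_def)
qed (simp add: qnum_def)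

lemma qfact_Suc: "qfact (Suc n) = qnum (Suc n) * qfact n"
  unfolding qfact_def by (simp add: mult.commute)

lemma qfact_dvd: "k \<le> n \<Longrightarrow> qfact k * qfact (n - k) dvd qfact n"
proof (induction n arbitrary: k)
  case (Suc n)
  show ?case
  proof (cases "k = 0 \<or> k = Suc n")
    case True
    then show ?thesis by (auto simp: qfact_def)
  next
    case False
    then obtain m where m: "k = Suc m" "m < n"
      using Suc.prems by (cases k) auto
    have d: "Suc n - k = Suc (n - k)" using m by simp
    have "qfact m * qfact (n - m) dvd qfact n" using Suc.IH m by simp
    then have "qnum k * (qfact m * qfact (n - m)) dvd qnum k * qfact n"
      by (rule mult_dvd_mono[OF dvd_refl])
    then have 1: "qfact k * qfact (Suc n - k) dvd qnum k * qfact n"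
      by (simp only: m qfact_Suc mult.assoc diff_Suc_Suc)
    have "qfact k * qfact (n - k) dvd qfact n" using Suc.IH m by simp
    then have "qnum (Suc n - k) * (qfact k * qfact (n - k)) dvd qnum (Suc n - k) * qfact n"
      by (rule mult_dvd_mono[OF dvd_refl])
    then have 2: "qfact k * qfact (Suc n - k) dvd qnum (Suc n - k) * qfact n"
      unfolding d qfact_Suc[of "n - k"] by (simp only: ac_simps)
    have "qfact (Suc n) = qnum k * qfact n + qvar ^ k * (qnum (Suc n - k) * qfact n)"
      unfolding qfact_Suc qnum_split[OF Suc.prems] by (simp only: distrib_right mult.assoc)
    then show ?thesis using 1 2 by (metis dvd_add dvd_mult)
  qed
qed (simp add: qfact_def)

lemma qbinom_mult: "k \<le> n \<Longrightarrow> qbinom n k * (qfact k * qfact (n - k)) = qfact n"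
  unfolding qbinom_def using qfact_dvd by simp

text \<open>
  Binomial coefficients with integer arguments, as they occur in \<open>Bcoeff\<close>: the usual value for
  $0 \le v \le u$, the value $1$ for $u = v \in \{-1, -2\}$, and $0$ otherwise.
  In particular $\binom{-1}{0} = 0$, in contrast to the generalised binomial coefficient
  \<open>gbinomial\<close>.  This value occurs for $k = 1$ and $i = n - 1$, and $0$ is what makes the two given
  expressions for $B^{n,k}_{i,j}$ agree: there the second one,
  $\frac{i+j+1}{n+j}\binom{n+j}{k-1}\binom{n-i-2}{k-2}$, is $\binom{-1}{-1} = 1$.
\<close>

definition ibinom :: "int \<Rightarrow> int \<Rightarrow> int" where
  "ibinom u v =
    (if 0 \<le> v \<and> v \<le> u then int (nat u choose nat v)
     else if u = v \<and> (u = -1 \<or> u = -2) then 1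
     else 0)"

definition Bcoeff :: "nat \<Rightarrow> nat \<Rightarrow> nat \<Rightarrow> nat \<Rightarrow> int" where
  "Bcoeff n k i j =
     ibinom (int n + int j - 1) (int k - 1) * ibinom (int n - int i - 1) (int k - 1)
   - ibinom (int n + int j) (int k - 1) * ibinom (int n - int i - 2) (int k - 1)"

definition rlm :: "nat \<Rightarrow> (nat \<Rightarrow> nat) \<Rightarrow> nat" where
  "rlm n \<sigma> = card {i \<in> {1..n}. \<forall>j. i < j \<and> j \<le> n \<longrightarrow> \<sigma> i > \<sigma> j}"

definition special_inversions :: "nat \<Rightarrow> (nat \<Rightarrow> nat) \<Rightarrow> (nat \<times> nat) set" where
  "special_inversions n \<sigma> =
    {(i, j). i \<in> {1..n} \<and> j \<in> {1..n} \<and> i < j \<and> \<sigma> i > \<sigma> j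
       \<and> (\<exists>k'. j < k' \<and> k' \<le> n \<and> \<sigma> i < \<sigma> k')}"

definition inv' :: "nat \<Rightarrow> (nat \<Rightarrow> nat) \<Rightarrow> nat" where
  "inv' n \<sigma> = card (special_inversions n \<sigma>)"

definition S1 :: "nat \<Rightarrow> nat \<Rightarrow> int poly" where
  "S1 n k = (\<Sum>\<sigma> | \<sigma> permutes {1..n} \<and> rlm n \<sigma> = k. qvar ^ inv' n \<sigma>)"

end

theory Submission
  imports Defs "HOL-Computational_Algebra.Formal_Power_Series"
begin

text \<open>
  Insert a virtual maximum behind position \<open>h\<close> and count only the right-to-left maxima to its right.
  Removing the true maximum of a permutation moves the virtual one, and the resulting sums \<open>T(n, h, k)\<close>
  satisfy \<open>T(n+1, h, k) = (\<Sum>p=h..n. T(n, p, k-1)) + [h]\<^sub>q T(n, h-1, k)\<close>; moreover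
  \<open>S\<^sub>1[n, k] = T(n, 0, k)\<close>.

  Let \<open>y\<close> and \<open>z\<close> mark \<open>k\<close> and \<open>n - k\<close>, and write \<open>y = (1 - s)(1 - r)\<close>, \<open>z = s r\<close>, \<open>\<rho> = 1/r\<close>
  with \<open>s\<close> the power series in \<open>z\<close> without constant term.  After multiplication of \<open>T(n, h, k)\<close> by
  \<open>(1 - q)\<^bsup>n-k\<^esup>\<close>, the recurrence is solved by the generating function
  \<open>\<rho> (\<Sum>m. (\<rho>; q)\<^sub>m (s q)\<^sup>m s\<^sup>h (q\<^bsup>m+1\<^esup>; q)\<^sub>h)\<close>, which for \<open>h = 0\<close> equals
  \<open>1 + y \<rho> (\<Sum>i. s\<^sup>i (q\<rho>; q)\<^sub>i)\<close>.  The \<open>q\<close>-binomial theorem expands the last product, and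
  \<open>B\<^sub>i\<^sub>,\<^sub>j\<close> is the coefficient of \<open>y\<^bsup>k-1\<^esup> z\<^bsup>n-k\<^esup>\<close> in \<open>s\<^sup>i \<rho>\<^bsup>j+1\<^esup>\<close>.
\<close>

section \<open>Permutations with a virtual maximum\<close>

text \<open>The disjunct \<open>j \<le> h\<close> lets the virtual maximum behind position
  \<open>h\<close> witness that a pair is special; the virtual maximum itself belongs to no
  pair.\<close>

definition inv_set_cut :: "nat \<Rightarrow> nat \<Rightarrow> (nat \<Rightarrow> nat) \<Rightarrow> (nat \<times> nat) set" where
  "inv_set_cut n h \<sigma> =
    {(i, j). i \<in> {1..n} \<and> j \<in> {1..n} \<and> i < j \<and> \<sigma> i > \<sigma> j
       \<and> (j \<le> h \<or> (\<exists>k'. j < k' \<and> k' \<le> n \<and> \<sigma> i < \<sigma> k'))}"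

definition rlm_set_cut :: "nat \<Rightarrow> nat \<Rightarrow> (nat \<Rightarrow> nat) \<Rightarrow> nat set" where
  "rlm_set_cut n h \<sigma> = {i \<in> {h<..n}. \<forall>j. i < j \<and> j \<le> n \<longrightarrow> \<sigma> i > \<sigma> j}"

definition cut_weight :: "nat \<Rightarrow> nat \<Rightarrow> nat \<Rightarrow> (nat \<Rightarrow> nat) \<Rightarrow> int poly" where
  "cut_weight n h k \<sigma> =
    (if card (rlm_set_cut n h \<sigma>) = k then qvar ^ card (inv_set_cut n h \<sigma>) else 0)"

definition cut_sum :: "nat \<Rightarrow> nat \<Rightarrow> nat \<Rightarrow> int poly" where
  "cut_sum n h k = (\<Sum>\<sigma> | \<sigma> permutes {1..n}. cut_weight n h k \<sigma>)"

text \<open>\<open>\<sigma> \<circ> max_cycle n p\<close> is the word of \<open>\<sigma>\<close> with \<open>n + 1\<close> inserted at position \<open>p\<close>; position \<open>i\<close> of \<open>\<sigma>\<close>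
  becomes position \<open>skip p i\<close>.\<close>

definition max_cycle :: "nat \<Rightarrow> nat \<Rightarrow> nat \<Rightarrow> nat" where
  "max_cycle n p i = (if i = p then Suc n else if p < i \<and> i \<le> Suc n then i - 1 else i)"

definition skip :: "nat \<Rightarrow> nat \<Rightarrow> nat" where
  "skip p i = (if i < p then i else Suc i)"

lemma S1_eq_cut_sum: "S1 n k = cut_sum n 0 k"
proof -
  have "rlm n \<sigma> = card (rlm_set_cut n 0 \<sigma>)" for \<sigma>
    unfolding rlm_def rlm_set_cut_def
    by (rule arg_cong[where f = card]) auto
  moreover have "inv' n \<sigma> = card (inv_set_cut n 0 \<sigma>)" for \<sigma>
    unfolding inv'_def special_inversions_def inv_set_cut_def
    by (rule arg_cong[where f = card]) auto
  ultimately show ?thesis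
    unfolding S1_def cut_sum_def cut_weight_def
    by (simp add: sum.inter_filter[symmetric] finite_permutations)
qed

lemma max_cycle_permutes:
  assumes "p \<in> {1..Suc n}"
  shows "max_cycle n p permutes {1..Suc n}"
proof (rule bij_imp_permutes)
  show "bij_betw (max_cycle n p) {1..Suc n} {1..Suc n}"
    by (rule bij_betw_byWitness[where f' = "\<lambda>i. if i = Suc n then p else skip p i"])
       (use assms in \<open>auto simp: max_cycle_def skip_def split: if_splits\<close>)
qed (use assms in \<open>auto simp: max_cycle_def\<close>)

lemma max_cycle_skip: "\<lbrakk>p \<in> {1..Suc n}; i \<in> {1..n}\<rbrakk> \<Longrightarrow> max_cycle n p (skip p i) = i"
  by (auto simp: max_cycle_def skip_def)

lemma max_cycle_self: "max_cycle n p p = Suc n"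
  by (simp add: max_cycle_def)

lemma skip_less_iff [simp]: "skip p i < skip p j \<longleftrightarrow> i < j"
  by (auto simp: skip_def)

lemma inj_skip: "inj (skip p)"
  by (rule injI) (auto simp: skip_def split: if_splits)

text \<open>The map (p, \<sigma>) to \<tau> is bijective: \<open>p\<close> is recovered as the
  position \<open>inv \<tau> (Suc n)\<close> of the maximum, and \<sigma> by undoing the
  cycle.\<close>

lemma sum_permutes_insert_max:
  fixes g :: "(nat \<Rightarrow> nat) \<Rightarrow> 'a :: comm_monoid_add"
  shows "(\<Sum>\<tau> | \<tau> permutes {1..Suc n}. g \<tau>) =
    (\<Sum>p = 1..Suc n. \<Sum>\<sigma> | \<sigma> permutes {1..n}. g (\<sigma> \<circ> max_cycle n p))"
proof -
  have sub: "\<sigma> permutes {1..Suc n}" if "\<sigma> permutes {1..n}" for \<sigma>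
    using that by (rule permutes_subset) auto
  have "(\<Sum>p = 1..Suc n. \<Sum>\<sigma> | \<sigma> permutes {1..n}. g (\<sigma> \<circ> max_cycle n p)) =
      (\<Sum>(p, \<sigma>) \<in> {1..Suc n} \<times> {\<sigma>. \<sigma> permutes {1..n}}. g (\<sigma> \<circ> max_cycle n p))"
    by (simp add: sum.cartesian_product)
  also have "\<dots> = (\<Sum>\<tau> | \<tau> permutes {1..Suc n}. g \<tau>)"
  proof (rule sum.reindex_bij_witness[where
        j = "\<lambda>(p, \<sigma>). \<sigma> \<circ> max_cycle n p" and
        i = "\<lambda>\<tau>. (inv \<tau> (Suc n), \<tau> \<circ> inv (max_cycle n (inv \<tau> (Suc n))))"])
    fix x assume x: "x \<in> {1..Suc n} \<times> {\<sigma>. \<sigma> permutes {1..n}}"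
    obtain p \<sigma> where [simp]: "x = (p, \<sigma>)" by (cases x)
    from x have p: "p \<in> {1..Suc n}" and \<sigma>: "\<sigma> permutes {1..n}" by auto
    have c: "max_cycle n p permutes {1..Suc n}" using p by (rule max_cycle_permutes)
    have t: "\<sigma> \<circ> max_cycle n p permutes {1..Suc n}"
      using c sub[OF \<sigma>] by (rule permutes_compose)
    have "(\<sigma> \<circ> max_cycle n p) p = Suc n"
      using permutes_not_in[OF \<sigma>, of "Suc n"] by (simp add: max_cycle_self)
    then have ip: "inv (\<sigma> \<circ> max_cycle n p) (Suc n) = p"
      using permutes_inverses(2)[OF t, of p] by simp
    have "\<sigma> \<circ> max_cycle n p \<circ> inv (max_cycle n p) = \<sigma>"
      using permutes_inv_o(1)[OF c] by (simp add: o_assoc[symmetric])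
    then show "(\<lambda>\<tau>. (inv \<tau> (Suc n), \<tau> \<circ> inv (max_cycle n (inv \<tau> (Suc n)))))
        ((\<lambda>(p, \<sigma>). \<sigma> \<circ> max_cycle n p) x) = x"
      using ip by (simp del: comp_apply)
    show "(\<lambda>(p, \<sigma>). \<sigma> \<circ> max_cycle n p) x \<in> {\<tau>. \<tau> permutes {1..Suc n}}"
      using t by simp
    show "g ((\<lambda>(p, \<sigma>). \<sigma> \<circ> max_cycle n p) x) = (case x of (p, \<sigma>) \<Rightarrow> g (\<sigma> \<circ> max_cycle n p))"
      by simp
  next
    fix \<tau> assume "\<tau> \<in> {\<tau>. \<tau> permutes {1..Suc n}}"
    then have t: "\<tau> permutes {1..Suc n}" by simp
    define p where "p = inv \<tau> (Suc n)"
    have p: "p \<in> {1..Suc n}"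
      unfolding p_def using permutes_in_image[OF permutes_inv[OF t], of "Suc n"] by simp
    have c: "max_cycle n p permutes {1..Suc n}" using p by (rule max_cycle_permutes)
    have \<tau>p: "\<tau> p = Suc n" unfolding p_def using permutes_inverses(1)[OF t] by simp
    have "inv (max_cycle n p) (Suc n) = p"
      using permutes_inverses(2)[OF c, of p] by (simp add: max_cycle_self)
    then have fix_max: "(\<tau> \<circ> inv (max_cycle n p)) (Suc n) = Suc n" using \<tau>p by simp
    have "\<tau> \<circ> inv (max_cycle n p) permutes {1..Suc n}"
      using permutes_inv[OF c] t by (rule permutes_compose)
    then have "\<tau> \<circ> inv (max_cycle n p) permutes {1..n}"
      by (rule permutes_superset) (use fix_max in \<open>auto simp: le_Suc_eq\<close>)
    then show "(inv \<tau> (Suc n), \<tau> \<circ> inv (max_cycle n (inv \<tau> (Suc n)))) \<in>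
        {1..Suc n} \<times> {\<sigma>. \<sigma> permutes {1..n}}"
      using p unfolding p_def by simp
    have "\<tau> \<circ> inv (max_cycle n p) \<circ> max_cycle n p = \<tau>"
      using permutes_inv_o(2)[OF c] by (simp add: o_assoc[symmetric])
    then show "(\<lambda>(p, \<sigma>). \<sigma> \<circ> max_cycle n p)
        (inv \<tau> (Suc n), \<tau> \<circ> inv (max_cycle n (inv \<tau> (Suc n)))) = \<tau>"
      unfolding p_def by simp
  qed
  finally show ?thesis ..
qed

section \<open>Effect of inserting the maximum on inversions and right-to-left maxima\<close>

context
  fixes n p :: nat and \<sigma> \<tau> :: "nat \<Rightarrow> nat"
  assumes p: "p \<in> {1..Suc n}" and \<sigma>: "\<sigma> permutes {1..n}"
    and \<tau>: "\<tau> = \<sigma> \<circ> max_cycle n p"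
begin

lemma position_cases [consumes 1, case_names max skip]:
  assumes "i \<in> {1..Suc n}"
  obtains "i = p" | i' where "i' \<in> {1..n}" "i = skip p i'"
proof (cases "i = p")
  case False
  with assms p have "(if i < p then i else i - 1) \<in> {1..n}"
      "i = skip p (if i < p then i else i - 1)"
    by (auto simp: skip_def)
  then show ?thesis using that(2) by blast
qed (use that(1) in simp)

lemma insert_max_self: "\<tau> p = Suc n"
  using permutes_not_in[OF \<sigma>, of "Suc n"] by (simp add: \<tau> max_cycle_self)

lemma insert_max_skip: "i \<in> {1..n} \<Longrightarrow> \<tau> (skip p i) = \<sigma> i"
  using max_cycle_skip[OF p] by (simp add: \<tau>)

lemma perm_le: "i \<in> {1..n} \<Longrightarrow> \<sigma> i \<le> n"
  using permutes_in_image[OF \<sigma>, of i] by simp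

lemma insert_max_le:
  assumes "i \<in> {1..Suc n}"
  shows "\<tau> i \<le> Suc n"
  using assms
proof (cases rule: position_cases)
  case max
  then show ?thesis by (simp add: insert_max_self)
next
  case (skip i')
  then show ?thesis using perm_le[of i'] by (simp add: insert_max_skip)
qed

text \<open>A later and larger value is either the inserted maximum, which lies behind
  \<open>skip p b\<close> exactly when \<open>b < p\<close>, or it stems from \<sigma>.\<close>

lemma insert_max_ex_greater:
  assumes "b \<in> {1..n}" "a \<in> {1..n}"
  shows "(\<exists>k'. skip p b < k' \<and> k' \<le> Suc n \<and> \<sigma> a < \<tau> k') \<longleftrightarrow>
    b < p \<or> (\<exists>k'. b < k' \<and> k' \<le> n \<and> \<sigma> a < \<sigma> k')" (is "?L \<longleftrightarrow> ?R")
proof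
  assume ?L
  then obtain k' where k': "skip p b < k'" "k' \<le> Suc n" "\<sigma> a < \<tau> k'" by blast
  then have "k' \<in> {1..Suc n}" by auto
  then show ?R
  proof (cases rule: position_cases)
    case max
    then show ?thesis using k'(1) by (auto simp: skip_def split: if_splits)
  next
    case (skip i')
    then show ?thesis using k' by (auto simp: insert_max_skip)
  qed
next
  assume ?R
  then show ?L
  proof
    assume "b < p"
    then show ?L using p insert_max_self perm_le[OF assms(2)]
      by (intro exI[of _ p]) (auto simp: skip_def)
  next
    assume "\<exists>k'. b < k' \<and> k' \<le> n \<and> \<sigma> a < \<sigma> k'"
    then obtain k' where "b < k'" "k' \<le> n" "\<sigma> a < \<sigma> k'" by blast
    then show ?L using assms
      by (intro exI[of _ "skip p k'"]) (auto simp: insert_max_skip, simp add: skip_def)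
  qed
qed

lemma skip_in: "i \<in> {1..n} \<Longrightarrow> skip p i \<in> {1..Suc n}"
  by (auto simp: skip_def)

text \<open>For pairs avoiding position \<open>p\<close>, the true and the virtual maximum together
  act like the one further right. Once position \<open>p\<close> is removed, that one stands behind
  \<open>p - 1\<close> if \<open>h < p\<close> and behind \<open>h - 1\<close> otherwise.\<close>

lemma inv_set_cut_skip_iff:
  assumes "a \<in> {1..n}" "b \<in> {1..n}"
  shows "(skip p a, skip p b) \<in> inv_set_cut (Suc n) h \<tau> \<longleftrightarrow>
    (a, b) \<in> inv_set_cut n (if h < p then p - 1 else h - 1) \<sigma>"
proof -
  have "skip p b \<le> h \<or> b < p \<longleftrightarrow> b \<le> (if h < p then p - 1 else h - 1)"
    using p by (auto simp: skip_def)
  then show ?thesis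
    using assms skip_in[OF assms(1)] skip_in[OF assms(2)]
    unfolding inv_set_cut_def mem_Collect_eq prod.case insert_max_skip[OF assms(1)]
      insert_max_skip[OF assms(2)] insert_max_ex_greater[OF assms(2,1)] skip_less_iff
    by (simp only: simp_thms) blast
qed

lemma inv_set_cut_snd_max: "(i, p) \<notin> inv_set_cut (Suc n) h \<tau>"
  using insert_max_le[of i] by (auto simp: inv_set_cut_def insert_max_self)

text \<open>Only the virtual maximum exceeds the value \<open>Suc n\<close>, so a special pair
  starting at \<open>p\<close> has to end at or before \<open>h\<close>.\<close>

lemma inv_set_cut_fst_max:
  assumes "h \<le> Suc n"
  shows "(p, j) \<in> inv_set_cut (Suc n) h \<tau> \<longleftrightarrow> p < j \<and> j \<le> h"
proof -
  have "\<tau> k' \<le> Suc n" if "j < k'" "k' \<le> Suc n" for k'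
    using that insert_max_le[of k'] by simp
  moreover have "\<tau> j < Suc n" if "p < j" "j \<le> h"
  proof -
    have "j \<in> {1..Suc n}" using that assms by simp
    then show ?thesis
      by (cases rule: position_cases)
         (use that perm_le in \<open>auto simp: insert_max_skip less_Suc_eq_le\<close>)
  qed
  ultimately show ?thesis
    using p assms by (auto simp: inv_set_cut_def insert_max_self not_less[symmetric])
qed

lemma inv_set_cut_insert_max:
  assumes "h \<le> Suc n"
  shows "inv_set_cut (Suc n) h \<tau> =
    map_prod (skip p) (skip p) ` inv_set_cut n (if h < p then p - 1 else h - 1) \<sigma> \<union> {p} \<times> {p<..h}"
    (is "_ = ?f ` ?A \<union> _")
proof (intro set_eqI iffI)
  fix x assume x: "x \<in> inv_set_cut (Suc n) h \<tau>"
  obtain i j where ij: "x = (i, j)" by (cases x)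
  with x have "i \<in> {1..Suc n}" "j \<in> {1..Suc n}" by (auto simp: inv_set_cut_def)
  from this(1) show "x \<in> ?f ` ?A \<union> {p} \<times> {p<..h}"
  proof (cases rule: position_cases)
    case max
    then show ?thesis using x ij inv_set_cut_fst_max[OF assms] by auto
  next
    case (skip a)
    from \<open>j \<in> {1..Suc n}\<close> show ?thesis
    proof (cases rule: position_cases)
      case max
      then show ?thesis using x ij inv_set_cut_snd_max by simp
    next
      case (skip b)
      then have "(a, b) \<in> ?A"
        using x ij \<open>a \<in> {1..n}\<close> \<open>i = skip p a\<close> inv_set_cut_skip_iff by simp
      then show ?thesis
        using ij skip \<open>i = skip p a\<close> by (auto intro!: image_eqI[where x = "(a, b)"])
    qed
  qed
next
  fix x assume "x \<in> ?f ` ?A \<union> {p} \<times> {p<..h}"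
  then show "x \<in> inv_set_cut (Suc n) h \<tau>"
  proof
    assume "x \<in> ?f ` ?A"
    then obtain y where y: "x = ?f y" "y \<in> ?A" by (rule imageE)
    obtain a b where "y = (a, b)" by (cases y)
    with y have ab: "(a, b) \<in> ?A" "x = (skip p a, skip p b)" by simp_all
    then have "a \<in> {1..n}" "b \<in> {1..n}" by (auto simp: inv_set_cut_def)
    then show ?thesis unfolding ab(2) using ab(1) inv_set_cut_skip_iff by simp
  next
    assume "x \<in> {p} \<times> {p<..h}"
    then have "x = (p, snd x)" "p < snd x \<and> snd x \<le> h" by auto
    then show ?thesis using inv_set_cut_fst_max[OF assms, of "snd x"] by simp
  qed
qed

text \<open>The new pairs are those from \<open>p\<close> to a position in \<open>{p<..h}\<close>;
  the truncated difference \<open>h - p\<close> is correctly 0 when \<open>h < p\<close>.\<close>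

lemma card_inv_set_cut_insert_max:
  assumes "h \<le> Suc n"
  shows "card (inv_set_cut (Suc n) h \<tau>) =
    card (inv_set_cut n (if h < p then p - 1 else h - 1) \<sigma>) + (h - p)"
proof -
  have fin: "finite (inv_set_cut n h' \<sigma>)" for h'
    by (rule finite_subset[of _ "{1..n} \<times> {1..n}"]) (auto simp: inv_set_cut_def)
  have "inj (map_prod (skip p) (skip p))"
    using inj_skip inj_skip by (rule prod.inj_map)
  then have "card (map_prod (skip p) (skip p) ` inv_set_cut n h' \<sigma>) = card (inv_set_cut n h' \<sigma>)" for h'
    by (rule card_image[OF inj_on_subset]) auto
  moreover have "map_prod (skip p) (skip p) ` inv_set_cut n h' \<sigma> \<inter> {p} \<times> {p<..h} = {}" for h'
    by (auto simp: skip_def split: if_splits)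
  ultimately show ?thesis
    unfolding inv_set_cut_insert_max[OF assms]
    by (subst card_Un_disjoint) (auto simp: fin card_cartesian_product)
qed

text \<open>The new maximum rules out all positions to its left and does not affect those to its
  right. It is a right-to-left maximum itself, but is counted only if \<open>h < p\<close>.\<close>

lemma rlm_set_cut_insert_max:
  "rlm_set_cut (Suc n) h \<tau> =
    (if h < p then insert p (skip p ` rlm_set_cut n (p - 1) \<sigma>) else skip p ` rlm_set_cut n (h - 1) \<sigma>)"
proof -
  have skip_iff: "skip p a \<in> rlm_set_cut (Suc n) h \<tau> \<longleftrightarrow>
      a \<in> rlm_set_cut n (if h < p then p - 1 else h - 1) \<sigma>" if a: "a \<in> {1..n}" for a
  proof -
    have "(\<forall>j. skip p a < j \<and> j \<le> Suc n \<longrightarrow> \<sigma> a > \<tau> j) \<longleftrightarrow>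
        \<not> a < p \<and> (\<forall>j. a < j \<and> j \<le> n \<longrightarrow> \<sigma> a > \<sigma> j)" (is "?L \<longleftrightarrow> ?R")
    proof
      assume L: ?L
      have "\<not> a < p"
      proof
        assume "a < p"
        then have "skip p a < p" by (simp add: skip_def)
        then have "\<tau> p < \<sigma> a" using L p by simp
        then show False using perm_le[OF a] insert_max_self by simp
      qed
      moreover have "\<sigma> j < \<sigma> a" if "a < j" "j \<le> n" for j
        using L[rule_format, of "skip p j"] that a skip_in[of j] insert_max_skip[of j] by simp
      ultimately show ?R by blast
    next
      assume R: ?R
      show ?L
      proof (intro allI impI)
        fix j assume j: "skip p a < j \<and> j \<le> Suc n"
        then have "j \<in> {1..Suc n}" by auto
        then show "\<tau> j < \<sigma> a"
        proof (cases rule: position_cases)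
          case max
          then show ?thesis using R j by (simp add: skip_def)
        next
          case (skip b)
          then show ?thesis using R j insert_max_skip by simp
        qed
      qed
    qed
    moreover have "h < skip p a \<and> \<not> a < p \<longleftrightarrow> (if h < p then p - 1 else h - 1) < a"
      using p by (auto simp: skip_def)
    moreover have "skip p a \<le> Suc n" "a \<le> n"
      using a skip_in[OF a] by simp_all
    ultimately show ?thesis
      unfolding rlm_set_cut_def mem_Collect_eq greaterThanAtMost_iff insert_max_skip[OF a] by blast
  qed
  have p_iff: "p \<in> rlm_set_cut (Suc n) h \<tau> \<longleftrightarrow> h < p"
  proof -
    have "\<tau> j < Suc n" if "p < j" "j \<le> Suc n" for j
    proof -
      have "j \<in> {1..Suc n}" using that by simp
      then show ?thesis
        by (cases rule: position_cases)
           (use that perm_le in \<open>auto simp: insert_max_skip less_Suc_eq_le\<close>)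
    qed
    then show ?thesis using p by (auto simp: rlm_set_cut_def insert_max_self)
  qed
  have sub: "rlm_set_cut m h' \<rho> \<subseteq> {1..m}" for m h' \<rho>
    by (auto simp: rlm_set_cut_def)
  have sub_skip: "skip p ` rlm_set_cut n h' \<sigma> \<subseteq> {1..Suc n}" for h'
    using sub[of n h' \<sigma>] skip_in by blast
  show ?thesis
  proof (intro set_eqI)
    fix x
    show "x \<in> rlm_set_cut (Suc n) h \<tau> \<longleftrightarrow> x \<in> (if h < p then
        insert p (skip p ` rlm_set_cut n (p - 1) \<sigma>) else skip p ` rlm_set_cut n (h - 1) \<sigma>)"
    proof (cases "x \<in> {1..Suc n}")
      case True
      then show ?thesis
      proof (cases rule: position_cases)
        case max
        then show ?thesis using p_iff by (auto simp: skip_def split: if_splits)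
      next
        case (skip a)
        have "skip p a \<noteq> p" by (simp add: skip_def)
        then show ?thesis
          using skip(1,2) skip_iff[OF skip(1)] by (simp add: inj_image_mem_iff[OF inj_skip])
      qed
    next
      case False
      then show ?thesis
        using sub[of "Suc n" h \<tau>] sub_skip p by (auto simp del: atLeastAtMost_iff split: if_splits)
    qed
  qed
qed

lemma card_rlm_set_cut_insert_max:
  "card (rlm_set_cut (Suc n) h \<tau>) =
    (if h < p then Suc (card (rlm_set_cut n (p - 1) \<sigma>)) else card (rlm_set_cut n (h - 1) \<sigma>))"
proof -
  have "finite (rlm_set_cut n h' \<sigma>)" for h'
    by (simp add: rlm_set_cut_def)
  moreover have "card (skip p ` rlm_set_cut n h' \<sigma>) = card (rlm_set_cut n h' \<sigma>)" for h'
    by (rule card_image[OF inj_on_subset[OF inj_skip]]) auto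
  moreover have "p \<notin> skip p ` A" for A
    by (auto simp: skip_def split: if_splits)
  ultimately show ?thesis
    by (simp add: rlm_set_cut_insert_max)
qed

lemma cut_weight_insert_max:
  assumes "h \<le> Suc n"
  shows "cut_weight (Suc n) h k \<tau> =
    (if h < p then (case k of 0 \<Rightarrow> 0 | Suc k' \<Rightarrow> cut_weight n (p - 1) k' \<sigma>)
     else qvar ^ (h - p) * cut_weight n (h - 1) k \<sigma>)"
proof (cases "h < p")
  case True
  then show ?thesis
    unfolding cut_weight_def card_rlm_set_cut_insert_max card_inv_set_cut_insert_max[OF assms]
    by (cases k) simp_all
next
  case False
  then show ?thesis
    unfolding cut_weight_def card_rlm_set_cut_insert_max card_inv_set_cut_insert_max[OF assms]
    by (simp only: if_False power_add mult.commute if_distrib[of "(*) _"] mult_zero_left mult_zero_right)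
qed

end

section \<open>Initial value and recurrence of the cut sums\<close>

lemma cut_sum_0: "cut_sum 0 0 k = (if k = 0 then 1 else 0)"
  by (simp add: cut_sum_def cut_weight_def rlm_set_cut_def inv_set_cut_def)

text \<open>Split by the position \<open>p\<close> of the maximum. Positions \<open>p > h\<close>
  give the first sum, shifted by one; positions \<open>p \<le> h\<close> all lead to
  \<open>h - 1\<close>, and their powers q^(h - p) add up to \<open>qnum h\<close>. At
  \<open>h = 0\<close> the factor \<open>qnum 0 = 0\<close> removes the term with the truncated
  index.\<close>

lemma cut_sum_Suc:
  assumes "h \<le> Suc n"
  shows "cut_sum (Suc n) h k =
    (case k of 0 \<Rightarrow> 0 | Suc k' \<Rightarrow> \<Sum>p = h..n. cut_sum n p k') + qnum h * cut_sum n (h - 1) k"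
proof -
  let ?t = "\<lambda>p. if h < p then (case k of 0 \<Rightarrow> 0 | Suc k' \<Rightarrow> cut_sum n (p - 1) k')
     else qvar ^ (h - p) * cut_sum n (h - 1) k"
  have "cut_sum (Suc n) h k =
      (\<Sum>p = 1..Suc n. \<Sum>\<sigma> | \<sigma> permutes {1..n}. cut_weight (Suc n) h k (\<sigma> \<circ> max_cycle n p))"
    unfolding cut_sum_def by (rule sum_permutes_insert_max)
  also have "\<dots> = (\<Sum>p = 1..Suc n. ?t p)"
  proof (rule sum.cong[OF refl])
    fix p assume p: "p \<in> {1..Suc n}"
    have "(\<Sum>\<sigma> | \<sigma> permutes {1..n}. cut_weight (Suc n) h k (\<sigma> \<circ> max_cycle n p)) =
      (\<Sum>\<sigma> | \<sigma> permutes {1..n}.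
        if h < p then (case k of 0 \<Rightarrow> 0 | Suc k' \<Rightarrow> cut_weight n (p - 1) k' \<sigma>)
        else qvar ^ (h - p) * cut_weight n (h - 1) k \<sigma>)"
      by (rule sum.cong[OF refl]) (use cut_weight_insert_max[OF p _ refl assms] in simp)
    also have "\<dots> = ?t p"
      by (simp add: cut_sum_def sum_distrib_left split: nat.split)
    finally show "(\<Sum>\<sigma> | \<sigma> permutes {1..n}. cut_weight (Suc n) h k (\<sigma> \<circ> max_cycle n p)) = ?t p" .
  qed
  also have "{1..Suc n} = {1..h} \<union> {Suc h..Suc n}"
    using assms by auto
  also have "sum ?t \<dots> = (\<Sum>p = 1..h. ?t p) + (\<Sum>p = Suc h..Suc n. ?t p)"
    by (rule sum.union_disjoint) auto
  also have "(\<Sum>p = 1..h. ?t p) = (\<Sum>p = 1..h. qvar ^ (h - p)) * cut_sum n (h - 1) k"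
    by (simp add: sum_distrib_right)
  also have "(\<Sum>p = 1..h. qvar ^ (h - p)) = qnum h"
    unfolding qnum_def
    by (rule sum.reindex_bij_witness[where i = "\<lambda>a. h - a" and j = "\<lambda>p. h - p"]) auto
  also have "(\<Sum>p = Suc h..Suc n. ?t p) =
      (\<Sum>p = h..n. case k of 0 \<Rightarrow> 0 | Suc k' \<Rightarrow> cut_sum n p k')"
    unfolding sum.shift_bounds_cl_Suc_ivl by (cases k) simp_all
  also have "\<dots> = (case k of 0 \<Rightarrow> 0 | Suc k' \<Rightarrow> \<Sum>p = h..n. cut_sum n p k')"
    by (simp split: nat.split)
  finally show ?thesis by (simp add: add.commute)
qed

unbundle fps_syntax

section \<open>The generating function\<close>

text \<open>The q-Pochhammer symbol (x; q)_m.\<close>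

definition qpoch :: "'a::comm_ring_1 \<Rightarrow> 'a \<Rightarrow> nat \<Rightarrow> 'a" where
  "qpoch x q m = (\<Prod>t<m. 1 - x * q ^ t)"

lemma qpoch_0 [simp]: "qpoch x q 0 = 1"
  by (simp add: qpoch_def)

lemma qpoch_Suc: "qpoch x q (Suc m) = qpoch x q m * (1 - x * q ^ m)"
  by (simp add: qpoch_def)

lemma qpoch_Suc_shift: "qpoch x q (Suc m) = (1 - x) * qpoch (x * q) q m"
  unfolding qpoch_def by (subst prod.lessThan_Suc_shift) (simp add: mult.assoc)

text \<open>The sum over m of (\<rho>; q)_m (s q)^m s^h (q^(m+1); q)_h as a series in s, with the
  outer factor \<rho> left off so that \<rho> may be any ring element.\<close>

definition height_fps :: "'a::comm_ring_1 \<Rightarrow> 'a \<Rightarrow> nat \<Rightarrow> 'a fps" where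
  "height_fps \<rho> q h = Abs_fps (\<lambda>i. if i < h then 0
     else qpoch \<rho> q (i - h) * q ^ (i - h) * qpoch (q ^ Suc (i - h)) q h)"

lemma height_fps_nth_add:
  "height_fps \<rho> q h $ (h + m) = qpoch \<rho> q m * q ^ m * qpoch (q ^ Suc m) q h"
  by (simp add: height_fps_def)

lemma height_fps_nth_less: "i < h \<Longrightarrow> height_fps \<rho> q h $ i = 0"
  by (simp add: height_fps_def)

text \<open>Up to the factor \<open>\<rho>\<close>, the recurrence in \<open>h\<close>: here \<open>fps_X\<close> is \<open>s\<close>, so that
  \<open>\<rho> z = s\<close> and \<open>\<rho> y = (1 - s)(\<rho> - 1)\<close>.\<close>

lemma height_fps_rec:
  fixes \<rho> q :: "'a::comm_ring_1"
  defines "g \<equiv> height_fps \<rho> q"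
  shows "fps_const \<rho> * (g h - g (Suc h)) =
    (1 - fps_X) * (fps_const (\<rho> - 1) * g h) + fps_const (1 - q ^ h) * (fps_X * g (h - 1))
      - fps_const (1 - q ^ Suc h) * (fps_X * g h) + (if h = 0 then 1 else 0)"
proof (rule fps_ext)
  fix i
  have lhs: "(fps_const \<rho> * (g h - g (Suc h))) $ i = \<rho> * (g h $ i - g (Suc h) $ i)"
    by simp
  have rhs: "((1 - fps_X) * (fps_const (\<rho> - 1) * g h) + fps_const (1 - q ^ h) * (fps_X * g (h - 1))
      - fps_const (1 - q ^ Suc h) * (fps_X * g h) + (if h = 0 then 1 else 0)) $ i =
      (\<rho> - 1) * (g h $ i - (case i of 0 \<Rightarrow> 0 | Suc i' \<Rightarrow> g h $ i'))
      + (1 - q ^ h) * (case i of 0 \<Rightarrow> 0 | Suc i' \<Rightarrow> g (h - 1) $ i')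
      - (1 - q ^ Suc h) * (case i of 0 \<Rightarrow> 0 | Suc i' \<Rightarrow> g h $ i')
      + (if h = 0 \<and> i = 0 then 1 else 0)"
    by (cases i) (simp_all add: algebra_simps)
  \<comment> \<open>The series \<open>g h\<close> starts in degree \<open>h\<close>, so degree
    \<open>h\<close> is treated apart; so is \<open>h = 0\<close>, where \<open>h - 1\<close>
    truncates.\<close>
  consider "i < h" | "i = 0" "h = 0" | h' where "i = h" "h = Suc h'"
    | m where "h = 0" "i = Suc m" | h' m where "h = Suc h'" "i = h + Suc m"
    by (cases h; cases i; cases "i < h"; cases "i = h")
       (auto, metis add_Suc_right add_Suc less_imp_Suc_add linorder_neqE_nat)
  then have "\<rho> * (g h $ i - g (Suc h) $ i) =
      (\<rho> - 1) * (g h $ i - (case i of 0 \<Rightarrow> 0 | Suc i' \<Rightarrow> g h $ i'))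
      + (1 - q ^ h) * (case i of 0 \<Rightarrow> 0 | Suc i' \<Rightarrow> g (h - 1) $ i')
      - (1 - q ^ Suc h) * (case i of 0 \<Rightarrow> 0 | Suc i' \<Rightarrow> g h $ i')
      + (if h = 0 \<and> i = 0 then 1 else 0)" (is ?coeffs)
  proof cases
    case 1
    then show ?coeffs
      by (cases i) (auto simp: g_def height_fps_nth_less)
  next
    case 2
    then show ?coeffs
      by (simp add: g_def height_fps_def)
  next
    case (3 h')
    \<comment> \<open>Only leading coefficients occur, and the claim reduces to (q; q)_h = (1 - q^h)
      (q; q)_(h-1).\<close>
    have "g (Suc h') $ Suc h' = qpoch q q (Suc h')" "g h' $ h' = qpoch q q h'"
      using height_fps_nth_add[of \<rho> q _ 0] by (simp_all add: g_def)
    then show ?coeffs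
      using 3 by (simp add: g_def height_fps_nth_less qpoch_Suc algebra_simps)
  next
    case (4 m)
    define P where "P = qpoch \<rho> q m"
    define Q where "Q = q ^ m"
    have "g 0 $ Suc m = P * (1 - \<rho> * Q) * (q * Q)" "g 0 $ m = P * Q"
      "g (Suc 0) $ Suc m = P * Q * (1 - q * Q)"
      by (simp_all add: g_def height_fps_def qpoch_Suc P_def Q_def)
    then show ?coeffs
      using 4 by simp (simp add: algebra_simps)
  next
    case (5 h' m)
    \<comment> \<open>All four coefficients are multiples of \<open>P * Q * \<beta>\<close>; what
      remains is a polynomial identity in \<rho>, \<open>q\<close>, \<open>Q\<close> and
      \<open>H\<close>.\<close>
    define P where "P = qpoch \<rho> q m"
    define Q where "Q = q ^ m"
    define H where "H = q ^ h'"
    define \<beta> where "\<beta> = qpoch (q ^ Suc (Suc m)) q h'"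
    have s: "qpoch (q ^ Suc m) q (Suc a) = (1 - q * Q) * qpoch (q ^ Suc (Suc m)) q a" for a
      by (subst qpoch_Suc_shift) (simp add: Q_def mult.commute)
    have t: "qpoch (q ^ Suc (Suc m)) q (Suc h') = \<beta> * (1 - q * q * Q * H)"
      by (simp add: qpoch_Suc \<beta>_def Q_def H_def mult.assoc)
    have i: "i = Suc h' + Suc m" "i = Suc (Suc h') + m" "Suc h' + m = h' + Suc m"
      using 5 by simp_all
    have "g (Suc h') $ i = P * (1 - \<rho> * Q) * (q * Q) * (\<beta> * (1 - q * q * Q * H))"
      unfolding i(1) g_def height_fps_nth_add t by (simp add: P_def Q_def qpoch_Suc)
    moreover have "g (Suc (Suc h')) $ i = P * Q * ((1 - q * Q) * (\<beta> * (1 - q * q * Q * H)))"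
      unfolding i(2) g_def height_fps_nth_add s t by (simp add: P_def Q_def)
    moreover have "g (Suc h') $ (Suc h' + m) = P * Q * ((1 - q * Q) * \<beta>)"
      unfolding g_def height_fps_nth_add s by (simp add: P_def Q_def \<beta>_def)
    moreover have "g h' $ (Suc h' + m) = P * (1 - \<rho> * Q) * (q * Q) * \<beta>"
      unfolding i(3) g_def height_fps_nth_add by (simp add: P_def Q_def \<beta>_def qpoch_Suc)
    ultimately show ?coeffs
      using 5 by (simp add: H_def[symmetric]) (simp add: algebra_simps)
  qed
  then show "(fps_const \<rho> * (g h - g (Suc h))) $ i =
    ((1 - fps_X) * (fps_const (\<rho> - 1) * g h) + fps_const (1 - q ^ h) * (fps_X * g (h - 1))
      - fps_const (1 - q ^ Suc h) * (fps_X * g h) + (if h = 0 then 1 else 0)) $ i"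
    unfolding lhs rhs .
qed

text \<open>In degree m + 1 both sides are multiples of (\<rho> q; q)_m, because (\<rho>; q)_(m+1) =
  (1 - \<rho>) (\<rho> q; q)_m. This form exposes the factor (1 - s)(\<rho> - 1) = y \<rho>, which
  acts on coefficients by lowering k.\<close>

lemma height_fps_0_eq:
  fixes \<rho> q :: "'a::comm_ring_1"
  shows "fps_const \<rho> * height_fps \<rho> q 0 =
    1 + (1 - fps_X) * (fps_const (\<rho> - 1) * Abs_fps (qpoch (\<rho> * q) q))"
proof (rule fps_ext)
  fix i
  show "(fps_const \<rho> * height_fps \<rho> q 0) $ i =
    (1 + (1 - fps_X) * (fps_const (\<rho> - 1) * Abs_fps (qpoch (\<rho> * q) q))) $ i"
  proof (cases i)
    case 0
    then show ?thesis by (simp add: height_fps_def left_diff_distrib)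
  next
    case (Suc m)
    define P where "P = qpoch (\<rho> * q) q m"
    define Q where "Q = q ^ m"
    have "height_fps \<rho> q 0 $ i = (1 - \<rho>) * P * (q * Q)"
      by (simp add: height_fps_def Suc qpoch_Suc_shift P_def Q_def)
    moreover have "qpoch (\<rho> * q) q i = P * (1 - \<rho> * q * Q)"
      by (simp add: Suc qpoch_Suc P_def Q_def)
    ultimately show ?thesis
      using Suc by (simp add: left_diff_distrib P_def[symmetric]) (simp add: algebra_simps)
  qed
qed

section \<open>Coefficient extraction\<close>

text \<open>The linear functional on polynomials that sends the l-th power of the variable to
  \<open>w l\<close>.\<close>

definition pairing :: "(nat \<Rightarrow> 'a::comm_ring_1) \<Rightarrow> 'a poly \<Rightarrow> 'a" where
  "pairing w p = (\<Sum>l\<le>degree p. coeff p l * w l)"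

lemma pairing_eq: "degree p \<le> N \<Longrightarrow> pairing w p = (\<Sum>l\<le>N. coeff p l * w l)"
  unfolding pairing_def by (rule sum.mono_neutral_left) (auto simp: coeff_eq_0)

lemma pairing_diff: "pairing w (p - r) = pairing w p - pairing w r"
proof -
  let ?N = "max (degree p) (degree r)"
  have "degree (p - r) \<le> ?N" by (rule degree_diff_le_max)
  then show ?thesis
    using pairing_eq[of p ?N w] pairing_eq[of r ?N w] pairing_eq[of "p - r" ?N w]
    by (simp add: left_diff_distrib sum_subtractf)
qed

lemma pairing_smult: "pairing w (smult c p) = c * pairing w p"
  using pairing_eq[where w = w, OF degree_smult_le[of c p]]
  by (simp add: pairing_def sum_distrib_left mult.assoc)

lemma pairing_pCons_0: "pairing w (pCons 0 p) = pairing (\<lambda>l. w (Suc l)) p"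
  using pairing_eq[where w = w, OF degree_pCons_le[of 0 p]]
  by (simp add: pairing_def sum.atMost_Suc_shift del: sum.atMost_Suc)

lemma pairing_0 [simp]: "pairing w 0 = 0"
  by (simp add: pairing_def)

lemma pairing_1 [simp]: "pairing w 1 = w 0"
  by (simp add: pairing_def)

lemma pairing_weight_diff: "pairing (\<lambda>l. v l - w l) p = pairing v p - pairing w p"
  by (simp add: pairing_def right_diff_distrib sum_subtractf)

text \<open>The functional sending s^i \<rho>^l to \<open>w i l\<close>, where \<rho> is the
  polynomial variable; the cutoff \<open>N\<close> makes the sum over i finite.\<close>

definition fps_pairing :: "(nat \<Rightarrow> nat \<Rightarrow> 'a::comm_ring_1) \<Rightarrow> nat \<Rightarrow> 'a poly fps \<Rightarrow> 'a" where
  "fps_pairing w N f = (\<Sum>i\<le>N. pairing (w i) (f $ i))"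

lemma fps_pairing_diff: "fps_pairing w N (f - g) = fps_pairing w N f - fps_pairing w N g"
  by (simp add: fps_pairing_def pairing_diff sum_subtractf)

lemma fps_pairing_add: "fps_pairing w N (f + g) = fps_pairing w N f + fps_pairing w N g"
  using fps_pairing_diff[of w N "f + g" g] by simp

lemma fps_pairing_const: "fps_pairing w N (fps_const [:c:] * f) = c * fps_pairing w N f"
  by (simp add: fps_pairing_def pairing_smult sum_distrib_left)

lemma fps_pairing_pCons_0:
  "fps_pairing w N (fps_const [:0, 1:] * f) = fps_pairing (\<lambda>i l. w i (Suc l)) N f"
  by (simp add: fps_pairing_def pairing_pCons_0)

text \<open>Multiplication by s shifts the index i by one; the assumption covers the one index that
  is pushed past the cutoff.\<close>

lemma fps_pairing_X:
  assumes "\<And>l. w (Suc N) l = 0"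
  shows "fps_pairing w N (fps_X * f) = fps_pairing (\<lambda>i. w (Suc i)) N f"
proof -
  have "fps_pairing w N (fps_X * f) = (\<Sum>i\<le>Suc N. pairing (w i) ((fps_X * f) $ i))"
    using assms by (simp add: fps_pairing_def pairing_def)
  also have "\<dots> = fps_pairing (\<lambda>i. w (Suc i)) N f"
    by (subst sum.atMost_Suc_shift) (simp add: fps_pairing_def)
  finally show ?thesis .
qed

lemma fps_pairing_1: "fps_pairing w N 1 = w 0 0"
proof -
  have "fps_pairing w N 1 = (\<Sum>i\<le>N. if i = 0 then w 0 0 else 0)"
    unfolding fps_pairing_def by (rule sum.cong) auto
  then show ?thesis by simp
qed

lemma fps_pairing_weight_diff:
  "fps_pairing (\<lambda>i l. v i l - w i l) N f = fps_pairing v N f - fps_pairing w N f"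
  by (simp add: fps_pairing_def pairing_weight_diff sum_subtractf)

lemma fps_pairing_extend:
  assumes "\<And>i l. i > N \<Longrightarrow> w i l = 0" "N \<le> M"
  shows "fps_pairing w M f = fps_pairing w N f"
  unfolding fps_pairing_def
proof (rule sum.mono_neutral_right)
  show "\<forall>i \<in> {..M} - {..N}. pairing (w i) (f $ i) = 0"
    using assms(1) by (simp add: pairing_def)
qed (use assms(2) in auto)

text \<open>The case distinction matters for \<open>k = 0\<close>: when \<open>i > n\<close> the
  truncated difference alone would give 1 instead of 0.\<close>

definition tbinom :: "nat \<Rightarrow> nat \<Rightarrow> nat \<Rightarrow> int" where
  "tbinom n i k = (if i \<le> n then int ((n - i) choose k) else 0)"

text \<open>\<open>weight n k i l\<close> is the coefficient of \<open>y\<^sup>k z\<^bsup>n+1-k\<^esup>\<close> in \<open>s\<^sup>i \<rho>\<^sup>l\<close>.\<close>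

definition weight :: "nat \<Rightarrow> nat \<Rightarrow> nat \<Rightarrow> nat \<Rightarrow> int" where
  "weight n k i l = int ((n + l) choose k) * tbinom (Suc n) i k
     - int (Suc (n + l) choose k) * tbinom (Suc n) (Suc i) k"

text \<open>Extraction of the coefficient of y^k z^(n+1-k) from a series in s whose coefficients are
  polynomials in \<rho> over Z[q]. The cutoff loses nothing, since all weights with
  \<open>i > Suc n\<close> vanish.\<close>

definition functional :: "nat \<Rightarrow> nat \<Rightarrow> int poly poly fps \<Rightarrow> int poly" where
  "functional n k = fps_pairing (\<lambda>i l. of_int (weight n k i l)) (Suc n)"

section \<open>The relations s = z \<rho> and (1 - s)(\<rho> - 1) = y \<rho> on coefficients\<close>

lemma tbinom_Suc_Suc: "tbinom (Suc n) (Suc i) k = tbinom n i k"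
  by (simp add: tbinom_def)

lemma tbinom_pascal: "tbinom (Suc n) i (Suc k) = tbinom (Suc n) (Suc i) (Suc k) + tbinom n i k"
proof (cases "i \<le> n")
  case True
  then show ?thesis by (simp add: tbinom_def Suc_diff_le)
qed (auto simp: tbinom_def)

lemma weight_eq_0: "i > Suc n \<Longrightarrow> weight n k i l = 0"
  by (simp add: weight_def tbinom_def)

text \<open>This is s = z \<rho>, read off at s^i \<rho>^l times either side.\<close>

lemma weight_Suc_Suc: "weight (Suc n) k (Suc i) l = weight n k i (Suc l)"
  by (simp add: weight_def tbinom_Suc_Suc)

text \<open>This is (1 - s)(\<rho> - 1) = y \<rho>, where the factor \<rho> on the right is
  rewritten through s = z \<rho>. It follows from Pascal's rule in both binomials.\<close>

lemma weight_mixed_difference: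
  "weight n (Suc k) i (Suc l) - weight n (Suc k) i l
    - (weight n (Suc k) (Suc i) (Suc l) - weight n (Suc k) (Suc i) l) = weight n k (Suc i) l"
proof -
  define a where "a = int ((n + l) choose k)"
  define b where "b = int (Suc (n + l) choose k)"
  define c where "c = int ((n + l) choose Suc k)"
  have 1: "int (Suc (n + l) choose Suc k) = a + c" "int (Suc (Suc (n + l)) choose Suc k) = b + (a + c)"
    unfolding a_def b_def c_def by simp_all
  show ?thesis
    unfolding weight_def add_Suc_right 1 a_def[symmetric] b_def[symmetric] c_def[symmetric]
      tbinom_pascal[of n i] tbinom_pascal[of n "Suc i"]
    by (simp add: tbinom_Suc_Suc algebra_simps)
qed

lemma functional_X: "functional n k (fps_X * f) =
    fps_pairing (\<lambda>i l. of_int (weight n k (Suc i) l)) (Suc n) f"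
  unfolding functional_def by (rule fps_pairing_X) (simp add: weight_eq_0)

lemma functional_X_eq_0:
  assumes "\<And>i. i \<le> n \<Longrightarrow> f $ i = 0"
  shows "functional n k (fps_X * f) = 0"
proof -
  have "pairing (\<lambda>l. of_int (weight n k (Suc i) l)) (f $ i) = 0" if "i \<le> Suc n" for i
  proof (cases "i = Suc n")
    case True
    then show ?thesis by (simp add: weight_eq_0 pairing_def)
  qed (use assms that in simp)
  then show ?thesis by (simp add: functional_X fps_pairing_def)
qed

lemma functional_Suc_X:
  "functional (Suc n) k (fps_X * f) = functional n k (fps_const [:0, 1:] * f)"
proof -
  have "functional (Suc n) k (fps_X * f) =
      fps_pairing (\<lambda>i l. of_int (weight n k i (Suc l))) (Suc (Suc n)) f"
    by (simp add: functional_X weight_Suc_Suc)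
  also have "\<dots> = fps_pairing (\<lambda>i l. of_int (weight n k i (Suc l))) (Suc n) f"
    \<comment> \<open>The two cutoffs differ by one index, at which the weight is 0.\<close>
    by (rule fps_pairing_extend) (auto simp: weight_eq_0)
  also have "\<dots> = functional n k (fps_const [:0, 1:] * f)"
    by (simp only: functional_def fps_pairing_pCons_0)
  finally show ?thesis .
qed

lemma functional_mixed_difference:
  "functional n k ((1 - fps_X) * (fps_const ([:0, 1:] - 1) * f)) =
    (case k of 0 \<Rightarrow> 0 | Suc k' \<Rightarrow> functional n k' (fps_X * f))"
proof -
  let ?w = "\<lambda>i l. of_int (weight n k i l) :: int poly"
  let ?\<rho> = "fps_const [:0, 1:] :: int poly poly fps"
  have "(1 - fps_X) * (fps_const ([:0, 1:] - 1) * f) =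
      ?\<rho> * f - f - (fps_X * (?\<rho> * f) - fps_X * f)"
    by (simp add: algebra_simps flip: fps_const_sub)
  then have "functional n k ((1 - fps_X) * (fps_const ([:0, 1:] - 1) * f)) =
      functional n k (?\<rho> * f) - functional n k f
        - (functional n k (fps_X * (?\<rho> * f)) - functional n k (fps_X * f))"
    by (simp only: functional_def fps_pairing_diff)
  also have "\<dots> = fps_pairing (\<lambda>i l. ?w i (Suc l)) (Suc n) f - fps_pairing ?w (Suc n) f
      - (fps_pairing (\<lambda>i l. ?w (Suc i) (Suc l)) (Suc n) f
        - fps_pairing (\<lambda>i l. ?w (Suc i) l) (Suc n) f)"
    by (simp only: functional_X) (simp only: functional_def fps_pairing_pCons_0)
  also have "\<dots> = fps_pairing (\<lambda>i l. ?w i (Suc l) - ?w i l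
      - (?w (Suc i) (Suc l) - ?w (Suc i) l)) (Suc n) f"
    by (simp only: fps_pairing_weight_diff)
  also have "\<dots> = (case k of 0 \<Rightarrow> 0 | Suc k' \<Rightarrow> functional n k' (fps_X * f))"
  proof (cases k)
    case 0
    \<comment> \<open>At \<open>k = 0\<close> the weight does not depend on l.\<close>
    have "?w i (Suc l) - ?w i l - (?w (Suc i) (Suc l) - ?w (Suc i) l) = 0" for i l
      unfolding 0 by (simp add: weight_def)
    then show ?thesis
      by (simp only: 0 nat.case) (simp add: fps_pairing_def pairing_def)
  next
    case (Suc k')
    have "?w i (Suc l) - ?w i l - (?w (Suc i) (Suc l) - ?w (Suc i) l) = of_int (weight n k' (Suc i) l)"
      for i l
      unfolding Suc weight_mixed_difference[of n k' i l, symmetric] by simp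
    then show ?thesis
      by (simp only: Suc nat.case functional_X)
  qed
  finally show ?thesis .
qed

text \<open>The constant 1 has no part of total degree n + 1 in y and z. Hence the inhomogeneous
  term of \<open>height_fps_rec\<close> disappears.\<close>

lemma functional_1: "functional n k 1 = 0"
  by (simp add: functional_def fps_pairing_1 weight_def tbinom_def mult.commute)

section \<open>The coefficients of the generating function and their recurrence\<close>

abbreviation path_fps :: "nat \<Rightarrow> int poly poly fps" where
  "path_fps \<equiv> height_fps [:0, 1:] [:qvar:]"

text \<open>Since s = z \<rho>, this is the coefficient of y^k z^(n-k) in \<rho> times
  \<open>path_fps h\<close>: the factor s supplies the missing \<rho> and absorbs the extra power of
  z.\<close>

definition path_sum :: "nat \<Rightarrow> nat \<Rightarrow> nat \<Rightarrow> int poly" where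
  "path_sum n h k = functional n k (fps_X * path_fps h)"

lemma path_sum_eq_0: "h > n \<Longrightarrow> path_sum n h k = 0"
  unfolding path_sum_def by (rule functional_X_eq_0) (simp add: height_fps_nth_less)

text \<open>Apply \<open>functional n k\<close> to \<open>height_fps_rec\<close>: the factor \<rho>
  on the left raises n, and (1 - s)(\<rho> - 1) lowers k.\<close>

lemma path_sum_diff:
  "path_sum (Suc n) h k - path_sum (Suc n) (Suc h) k =
    (case k of 0 \<Rightarrow> 0 | Suc k' \<Rightarrow> path_sum n h k') + (1 - qvar ^ h) * path_sum n (h - 1) k
      - (1 - qvar ^ Suc h) * path_sum n h k"
proof -
  have c: "(1 - [:qvar:] ^ a :: int poly poly) = [:1 - qvar ^ a:]" for a
    by (simp add: poly_const_pow one_pCons)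
  have d: "functional n k (if h = 0 then 1 else 0) = 0"
    using functional_1 by (simp add: functional_def fps_pairing_def)
  have "path_sum (Suc n) h k - path_sum (Suc n) (Suc h) k =
      functional n k (fps_const [:0, 1:] * (path_fps h - path_fps (Suc h)))"
    by (simp only: path_sum_def functional_Suc_X right_diff_distrib)
       (simp only: functional_def fps_pairing_diff)
  also have "\<dots> = functional n k ((1 - fps_X) * (fps_const ([:0, 1:] - 1) * path_fps h))
      + (1 - qvar ^ h) * path_sum n (h - 1) k - (1 - qvar ^ Suc h) * path_sum n h k
      + functional n k (if h = 0 then 1 else 0)"
    unfolding height_fps_rec c path_sum_def functional_def
    by (simp only: fps_pairing_diff fps_pairing_add fps_pairing_const)
  also have "\<dots> = (case k of 0 \<Rightarrow> 0 | Suc k' \<Rightarrow> path_sum n h k') + (1 - qvar ^ h) * path_sum n (h - 1) k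
      - (1 - qvar ^ Suc h) * path_sum n h k"
    unfolding functional_mixed_difference d path_sum_def by simp
  finally show ?thesis .
qed

text \<open>Sum the differences downwards from \<open>h = Suc n\<close>, where the next term
  \<open>path_sum (Suc n) (Suc (Suc n)) k\<close> is 0.\<close>

lemma path_sum_Suc:
  assumes "h \<le> Suc n"
  shows "path_sum (Suc n) h k =
    (case k of 0 \<Rightarrow> 0 | Suc k' \<Rightarrow> \<Sum>p = h..n. path_sum n p k') + (1 - qvar ^ h) * path_sum n (h - 1) k"
  using assms
proof (induction h rule: inc_induct)
  case base
  have "path_sum (Suc n) (Suc n) k = path_sum (Suc n) (Suc n) k - path_sum (Suc n) (Suc (Suc n)) k"
    by (simp add: path_sum_eq_0)
  also have "\<dots> = (1 - qvar ^ Suc n) * path_sum n n k"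
    unfolding path_sum_diff by (simp add: path_sum_eq_0 split: nat.split)
  finally show ?case by (simp split: nat.split)
next
  case (step h)
  have "path_sum (Suc n) h k = (path_sum (Suc n) h k - path_sum (Suc n) (Suc h) k)
      + path_sum (Suc n) (Suc h) k"
    by simp
  also have "\<dots> = (case k of 0 \<Rightarrow> 0 | Suc k' \<Rightarrow> path_sum n h k' + (\<Sum>p = Suc h..n. path_sum n p k'))
      + (1 - qvar ^ h) * path_sum n (h - 1) k"
    unfolding path_sum_diff unfolding step.IH by (cases k) simp_all
  also have "(case k of 0 \<Rightarrow> 0 | Suc k' \<Rightarrow> path_sum n h k' + (\<Sum>p = Suc h..n. path_sum n p k')) =
      (case k of 0 \<Rightarrow> 0 | Suc k' \<Rightarrow> \<Sum>p = h..n. path_sum n p k')"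
    using step.hyps by (cases k) (simp_all add: sum.atLeast_Suc_atMost)
  finally show ?case .
qed

lemma path_sum_0: "path_sum 0 0 k = (if k = 0 then 1 else 0)"
  by (simp add: path_sum_def functional_X fps_pairing_def height_fps_def weight_def tbinom_def
      pairing_def binomial_eq_0)

text \<open>Insert \<open>height_fps_0_eq\<close>; its constant 1 contributes nothing and its factor
  (1 - s)(\<rho> - 1) lowers \<open>Suc k\<close> to \<open>k\<close>.\<close>

lemma path_sum_Suc_0_Suc:
  "path_sum (Suc n) 0 (Suc k) =
    (\<Sum>i\<le>Suc n. pairing (\<lambda>l. of_int (weight n k (Suc i) l)) (qpoch [:0, qvar:] [:qvar:] i))"
proof -
  have "path_sum (Suc n) 0 (Suc k) = functional n (Suc k) (fps_const [:0, 1:] * path_fps 0)"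
    by (simp only: path_sum_def functional_Suc_X)
  also have "\<dots> = functional n (Suc k) 1 + functional n (Suc k) ((1 - fps_X) *
      (fps_const ([:0, 1:] - 1) * Abs_fps (qpoch ([:0, 1:] * [:qvar:]) [:qvar:])))"
    by (simp only: height_fps_0_eq functional_def fps_pairing_add)
  also have "\<dots> = functional n k (fps_X * Abs_fps (qpoch ([:0, 1:] * [:qvar:]) [:qvar:]))"
    by (simp only: functional_1 functional_mixed_difference nat.case add_0)
  also have "[:0, 1:] * [:qvar:] = [:0, qvar:]"
    by simp
  finally show ?thesis
    by (simp add: functional_X fps_pairing_def)
qed

section \<open>The \<open>q\<close>-binomial theorem and the main identity\<close>

lemma one_minus_qvar_mult_qnum: "(1 - qvar) * qnum h = 1 - qvar ^ h"
  unfolding qnum_def by (rule one_diff_power_eq[symmetric])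

lemma qnum_Suc_neq_0: "qnum (Suc i) \<noteq> 0"
proof
  assume "qnum (Suc i) = 0"
  then have "poly (qnum (Suc i)) 1 = 0" by simp
  then show False unfolding qnum_def by (simp add: poly_sum)
qed

lemma qfact_neq_0: "qfact n \<noteq> 0"
  by (induction n) (simp_all add: qfact_Suc qnum_Suc_neq_0, simp add: qfact_def)

lemma qbinom_eq_0: "n < k \<Longrightarrow> qbinom n k = 0"
  by (simp add: qbinom_def)

lemma qbinom_0_right: "qbinom n 0 = 1"
  using qfact_neq_0[of n] by (simp add: qbinom_def, simp add: qfact_def)

text \<open>For \<open>k < n\<close>, multiplying by [k+1]! [n-k]! turns every term into a multiple
  of [n]!, and the claim becomes [n+1] = [n-k] + q^(n-k) [k+1].\<close>

lemma qbinom_Suc_Suc: "qbinom (Suc n) (Suc k) = qbinom n (Suc k) + qvar ^ (n - k) * qbinom n k"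
proof (cases "k < n")
  case True
  then obtain d where d: "n - k = Suc d" "n - Suc k = d"
    by (metis Suc_diff_Suc)
  let ?c = "qfact (Suc k) * qfact (n - k)"
  have "qbinom (Suc n) (Suc k) * ?c = qnum (Suc n) * qfact n"
    using qbinom_mult[of "Suc k" "Suc n"] True by (simp add: qfact_Suc)
  moreover have "qbinom n (Suc k) * ?c = qnum (n - k) * qfact n"
    using qbinom_mult[of "Suc k" n] True unfolding d(2)
    by (simp only: d qfact_Suc[of d]) (simp add: ac_simps)
  moreover have "qbinom n k * ?c = qnum (Suc k) * qfact n"
    using qbinom_mult[of k n] True by (simp only: qfact_Suc[of k]) (simp add: ac_simps)
  moreover have "qnum (Suc n) = qnum (n - k) + qvar ^ (n - k) * qnum (Suc k)"
    using qnum_split[of "n - k" "Suc n"] True by (simp add: Suc_diff_le)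
  ultimately have "qbinom (Suc n) (Suc k) * ?c = (qbinom n (Suc k) + qvar ^ (n - k) * qbinom n k) * ?c"
    by (simp only: distrib_right mult.assoc)
  then show ?thesis using qfact_neq_0 by simp
next
  case False
  then consider "k = n" | "k > n" by linarith
  then show ?thesis
  proof cases
    case 1
    have "qbinom m m = 1" for m
      using qfact_neq_0[of m] by (simp add: qbinom_def, simp add: qfact_def)
    then show ?thesis using 1 by (simp add: qbinom_eq_0)
  qed (simp add: qbinom_eq_0)
qed

text \<open>The q-binomial theorem for (q x; q)_i, by induction on i: the last factor 1 - q^(i+1) x
  matches the q-Pascal rule.\<close>

lemma coeff_qpoch:
  "coeff (qpoch [:0, qvar:] [:qvar:] i) l = (-1) ^ l * qvar ^ (Suc l choose 2) * qbinom i l"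
proof (induction i arbitrary: l)
  case 0
  show ?case by (cases l) (simp_all add: qbinom_eq_0 qbinom_0_right numeral_2_eq_2)
next
  case (Suc i)
  have "qpoch [:0, qvar:] [:qvar:] (Suc i) = qpoch [:0, qvar:] [:qvar:] i
      - pCons 0 (smult (qvar ^ Suc i) (qpoch [:0, qvar:] [:qvar:] i))"
    by (simp add: qpoch_Suc poly_const_pow right_diff_distrib)
  then have coeff_Suc: "coeff (qpoch [:0, qvar:] [:qvar:] (Suc i)) l = coeff (qpoch [:0, qvar:] [:qvar:] i) l
      - (case l of 0 \<Rightarrow> 0 | Suc l' \<Rightarrow> qvar ^ Suc i * coeff (qpoch [:0, qvar:] [:qvar:] i) l')" for l
    by (simp add: coeff_pCons split: nat.split)
  show ?case
  proof (cases l)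
    case 0
    then show ?thesis by (simp add: coeff_Suc Suc.IH qbinom_0_right)
  next
    case (Suc l')
    have e: "Suc (Suc l') choose 2 = Suc l' + (Suc l' choose 2)"
      by (simp add: numeral_2_eq_2)
    \<comment> \<open>For \<open>l' \<le> i\<close> the exponent i + 1 splits as (l' + 1) + (i -
      l'), and l' + 1 is the increment of the triangular number; otherwise the q-binomial is
      0.\<close>
    have shift: "qvar ^ (Suc l' choose 2) * (qvar ^ Suc i * qbinom i l') =
        qvar ^ (Suc (Suc l') choose 2) * (qvar ^ (i - l') * qbinom i l')"
    proof (cases "l' \<le> i")
      case True
      then have "Suc i = Suc l' + (i - l')" by simp
      then have "qvar ^ Suc i = qvar ^ Suc l' * qvar ^ (i - l')" by (simp only: power_add)
      then show ?thesis by (simp only: e power_add ac_simps)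
    qed (simp add: qbinom_eq_0)
    have "qvar ^ Suc i * ((-1) ^ l' * qvar ^ (Suc l' choose 2) * qbinom i l') =
        (-1) ^ l' * (qvar ^ (Suc l' choose 2) * (qvar ^ Suc i * qbinom i l'))"
      by (simp only: ac_simps)
    then have "qvar ^ Suc i * ((-1) ^ l' * qvar ^ (Suc l' choose 2) * qbinom i l') =
        (-1) ^ l' * (qvar ^ (Suc (Suc l') choose 2) * (qvar ^ (i - l') * qbinom i l'))"
      by (simp only: shift)
    then show ?thesis
      unfolding coeff_Suc Suc nat.case Suc.IH qbinom_Suc_Suc
      by (simp only: power_Suc[of "-1"] distrib_left mult.assoc mult_minus_left mult_1_left
          diff_conv_add_uminus)
  qed
qed

lemma degree_qpoch: "degree (qpoch [:0, qvar:] [:qvar:] i) \<le> i"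
  by (rule degree_le) (simp add: coeff_qpoch qbinom_eq_0)

section \<open>Identification of the coefficients with B\<close>

lemma ibinom_int: "ibinom (int u) (int v) = int (u choose v)"
  by (simp add: ibinom_def binomial_eq_0)

lemma Bcoeff_Suc_Suc:
  assumes "i \<le> n"
  shows "Bcoeff (Suc n) (Suc k) i j = weight n k (Suc i) j"
proof -
  have "ibinom (int n - int i - 1) (int k) = tbinom n (Suc i) k"
  proof (cases "i = n")
    case True
    \<comment> \<open>The upper argument is -1 here, and both conventions give 0, also for
      \<open>k = 0\<close>.\<close>
    then show ?thesis by (simp add: ibinom_def tbinom_def)
  next
    case False
    with assms have "int n - int i - 1 = int (n - Suc i)" by (simp add: of_nat_diff)
    then show ?thesis using assms False by (simp only: ibinom_int) (simp add: tbinom_def)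
  qed
  moreover have "ibinom (int n - int i) (int k) = tbinom n i k"
    using ibinom_int[of "n - i" k] assms by (simp add: tbinom_def of_nat_diff)
  moreover have "ibinom (int n + int j) (int k) = int ((n + j) choose k)"
    using ibinom_int[of "n + j" k] by simp
  moreover have "ibinom (1 + int n + int j) (int k) = int (Suc (n + j) choose k)"
    using ibinom_int[of "Suc (n + j)" k] by (simp add: add.assoc)
  ultimately show ?thesis
    unfolding Bcoeff_def weight_def tbinom_Suc_Suc by (simp add: algebra_simps)
qed

lemma path_sum_eq_Bcoeff_sum:
  assumes "k \<le> n"
  shows "path_sum (Suc n) 0 (Suc k) = (\<Sum>j = 0..n - k. \<Sum>i = j..n - k.
      (-1) ^ j * of_int (Bcoeff (Suc n) (Suc k) i j) * qvar ^ (Suc j choose 2) * qbinom i j)"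
proof -
  let ?t = "\<lambda>i j. (-1) ^ j * of_int (Bcoeff (Suc n) (Suc k) i j) * qvar ^ (Suc j choose 2) * qbinom i j"
  let ?p = "\<lambda>i. pairing (\<lambda>l. of_int (weight n k (Suc i) l)) (qpoch [:0, qvar:] [:qvar:] i)"
  have "?p i = 0" if "i > n - k" for i
  proof -
    \<comment> \<open>Both \<open>tbinom\<close> factors vanish: either the upper index is below
      \<open>k\<close>, or \<open>i > n\<close>.\<close>
    have "weight n k (Suc i) l = 0" for l
      using that assms unfolding weight_def tbinom_Suc_Suc by (simp add: tbinom_def binomial_eq_0)
    then show ?thesis by (simp add: pairing_def)
  qed
  then have "path_sum (Suc n) 0 (Suc k) = (\<Sum>i\<in>{0..n - k}. ?p i)"
    unfolding path_sum_Suc_0_Suc by (intro sum.mono_neutral_right) auto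
  also have "\<dots> = (\<Sum>i\<in>{0..n - k}. \<Sum>j | j \<in> {0..n - k} \<and> j \<le> i. ?t i j)"
  proof (rule sum.cong[OF refl])
    fix i assume i: "i \<in> {0..n - k}"
    then have "{j. j \<in> {0..n - k} \<and> j \<le> i} = {..i}" by auto
    moreover have "?p i = (\<Sum>j\<le>i. ?t i j)"
      unfolding pairing_eq[OF degree_qpoch] coeff_qpoch
      by (rule sum.cong) (use i in \<open>simp_all add: Bcoeff_Suc_Suc ac_simps\<close>)
    ultimately show "?p i = (\<Sum>j | j \<in> {0..n - k} \<and> j \<le> i. ?t i j)" by simp
  qed
  also have "\<dots> = (\<Sum>j\<in>{0..n - k}. \<Sum>i | i \<in> {0..n - k} \<and> j \<le> i. ?t i j)"
    by (rule sum.swap_restrict) auto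
  also have "\<dots> = (\<Sum>j = 0..n - k. \<Sum>i = j..n - k. ?t i j)"
    by (intro sum.cong refl) auto
  finally show ?thesis .
qed

text \<open>The two recurrences differ only in \<open>qnum h\<close> against 1 - q^h, a factor 1 -
  q. Powers stand on both sides because k is arbitrary in the induction and \<open>n - k\<close>
  would truncate for \<open>k > n\<close>.\<close>

lemma cut_sum_eq_path_sum:
  assumes "h \<le> n"
  shows "(1 - qvar) ^ n * cut_sum n h k = (1 - qvar) ^ k * path_sum n h k"
  using assms
proof (induction n arbitrary: h k)
  case 0
  then show ?case by (simp add: cut_sum_0 path_sum_0)
next
  case (Suc n)
  let ?c = "1 - qvar"
  \<comment> \<open>In this part n and k drop together, so the powers on both sides gain the same
    factor.\<close>
  have sums: "?c ^ Suc n * (case k of 0 \<Rightarrow> 0 | Suc k' \<Rightarrow> \<Sum>p = h..n. cut_sum n p k') =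
      ?c ^ k * (case k of 0 \<Rightarrow> 0 | Suc k' \<Rightarrow> \<Sum>p = h..n. path_sum n p k')"
  proof (cases k)
    case (Suc k')
    have "?c ^ n * (\<Sum>p = h..n. cut_sum n p k') = ?c ^ k' * (\<Sum>p = h..n. path_sum n p k')"
      unfolding sum_distrib_left by (rule sum.cong) (simp_all only: Suc.IH atLeastAtMost_iff)
    then show ?thesis by (simp only: Suc nat.case power_Suc mult.assoc)
  qed (simp only: nat.case mult_zero_right)
  have "?c ^ Suc n * (qnum h * cut_sum n (h - 1) k) = (?c * qnum h) * (?c ^ n * cut_sum n (h - 1) k)"
    by (simp only: power_Suc ac_simps)
  also have "\<dots> = (1 - qvar ^ h) * (?c ^ k * path_sum n (h - 1) k)"
    using Suc.prems by (subst Suc.IH) (auto simp only: one_minus_qvar_mult_qnum)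
  finally have "?c ^ Suc n * (qnum h * cut_sum n (h - 1) k) =
      ?c ^ k * ((1 - qvar ^ h) * path_sum n (h - 1) k)"
    by (simp only: ac_simps)
  then show ?case
    unfolding cut_sum_Suc[OF Suc.prems] path_sum_Suc[OF Suc.prems] distrib_left sums by (rule arg_cong)
qed

text \<open>Multiply by (1 - q)^k, compare at \<open>h = 0\<close>, and cancel this nonzero
  polynomial.\<close>

lemma qvar_power_mult_S1:
  assumes "k \<le> n"
  shows "(1 - qvar) ^ (n - k) * S1 n k = path_sum n 0 k"
proof -
  have "(1 - qvar) ^ k * ((1 - qvar) ^ (n - k) * S1 n k) = (1 - qvar) ^ n * cut_sum n 0 k"
    using assms by (simp only: S1_eq_cut_sum mult.assoc[symmetric] power_add[symmetric]
        le_add_diff_inverse)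
  also have "\<dots> = (1 - qvar) ^ k * path_sum n 0 k"
    by (rule cut_sum_eq_path_sum) simp
  finally show ?thesis by (simp add: one_pCons)
qed

text \<open>The lower arguments are -1 and the first factor of each product has a nonnegative upper
  argument, hence is 0.\<close>

lemma Bcoeff_Suc_0: "Bcoeff (Suc n) 0 i j = 0"
  by (simp add: Bcoeff_def ibinom_def)

theorem theorem5p5:
  fixes n k :: nat
  assumes "k \<le> n"
  shows "(1 - qvar) ^ (n - k) * S1 n k =
    (\<Sum>j=0..n-k. \<Sum>i=j..n-k.
      (-1) ^ j * of_int (Bcoeff n k i j) * qvar ^ ((j + 1) choose 2) * qbinom i j)"
proof (cases k)
  case 0
  show ?thesis
  proof (cases n)
    case 0
    \<comment> \<open>The only term is 1, by the convention
      \<open>ibinom (-1) (-1) = 1\<close>.\<close>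
    then show ?thesis
      using \<open>k = 0\<close>
      by (simp add: S1_eq_cut_sum cut_sum_0 Bcoeff_def ibinom_def qbinom_0_right binomial_eq_0)
  next
    case (Suc m)
    then have "S1 n k = 0"
      using \<open>k = 0\<close> by (simp add: S1_eq_cut_sum cut_sum_Suc qnum_def)
    then show ?thesis
      using \<open>k = 0\<close> Suc by (simp add: Bcoeff_Suc_0)
  qed
next
  case (Suc k')
  with assms obtain m where m: "n = Suc m" "k' \<le> m" by (cases n) auto
  show ?thesis
    unfolding qvar_power_mult_S1[OF assms]
    using path_sum_eq_Bcoeff_sum[OF m(2)] by (simp only: Suc m(1) diff_Suc_Suc Suc_eq_plus1[symmetric])
qed

end
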